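(* Let $r$ and $\epsilon$ be fixed real numbers with $0<r<1$ and $0<\epsilon<1$. For each positive integer $n$, let $M=\lfloor 10^{n/2}\rfloor$, let $a_1,\ldots,a_n$ be independent and identically distributed random variables, each uniformly distributed on $\{1,2,\ldots,M\}$, and let $\beta=\lfloor r\sum_{j=1}^{n}a_j\rfloor$. Then the probability that the subset sum instance $$\sum_{j=1}^n a_jx_j=\beta,\qquad x\in\{0,1\}^n,$$ requires the creation of at least $2^{n^{1-\epsilon}}$ branch-and-bound nodes by ordinary branch-and-bound when one branches on the individual variables in any order (i.e., at least this many nodes are created whatever the branching order is) goes to $1$ as $n\to\infty$.
   Context: Given positive integers $a_1,\ldots,a_n$ and a right-hand side $\beta$, the subset sum problem (feasibility version) asks whether there is $x\in\{0,1\}^n$ with $\sum_{j=1}^n a_jx_j=\beta$. Ordinary branch-and-bound (branching on individual variables) for this problem builds a rooted binary tree. Each node corresponds to a partial assignment, i.e. a set $I\subseteq\{1,\ldots,n\}$ of indices of fixed variables together with values $x_i\in\{0,1\}$ for $i\in I$; at the root $I=\emptyset$. At a node one considers the LP relaxation, i.e. the system $\sum_{j=1}^n a_jx_j=\beta$, $0\le x_j\le 1$ for all $j$, with $x_i$ equal to its fixed value for $i\in I$. If the LP relaxation is infeasible, the node is pruned (by infeasibility). If a feasible solution in $\{0,1\}^n$ is found, the algorithm stops. Otherwise an unfixed variable $x_j$, $j\notin I$, is chosen and two child nodes are created, by additionally fixing $x_j=0$ and $x_j=1$ respectively. The choice of branching variable at each node is arbitrary ("any order"). For an infeasible instance, the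 algorithm ends when all leaves have been pruned by infeasibility. The number of created nodes is the number of nodes of the tree. *)

theory Defs
  imports "HOL-Probability.Probability"
begin

text \<open>
  A subset sum instance is given by \<open>n\<close>, the coefficients \<open>a 1, \<dots>, a n\<close> and the right-hand
  side \<open>b\<close>.  A node of the branch-and-bound tree is a partial assignment \<open>p\<close>, whose domain is
  the set of indices of the fixed variables.
\<close>

definition lp_solution ::
  "nat \<Rightarrow> (nat \<Rightarrow> nat) \<Rightarrow> int \<Rightarrow> (nat \<rightharpoonup> bool) \<Rightarrow> (nat \<Rightarrow> real) \<Rightarrow> bool" where
  "lp_solution n a b p x \<longleftrightarrow>
     (\<Sum>j=1..n. real (a j) * x j) = real_of_int b \<and>
     (\<forall>j\<in>{1..n}. 0 \<le> x j \<and> x j \<le> 1) \<and>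
     (\<forall>j\<in>{1..n}. \<forall>v. p j = Some v \<longrightarrow> x j = of_bool v)"

definition lp_feasible :: "nat \<Rightarrow> (nat \<Rightarrow> nat) \<Rightarrow> int \<Rightarrow> (nat \<rightharpoonup> bool) \<Rightarrow> bool" where
  "lp_feasible n a b p \<longleftrightarrow> (\<exists>x. lp_solution n a b p x)"

text \<open>
  \<open>Open\<close> is a node that has been created but not processed; such nodes are left over when the
  algorithm stops early because a 0/1 solution has been found elsewhere in the tree.
\<close>

datatype leaf_status = Open | Pruned | Solved

datatype bb_tree = BBLeaf leaf_status | BBNode nat bb_tree bb_tree

fun leaf_statuses :: "bb_tree \<Rightarrow> leaf_status set" where
  "leaf_statuses (BBLeaf s) = {s}"
| "leaf_statuses (BBNode j l r) = leaf_statuses l \<union> leaf_statuses r"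

fun num_nodes :: "bb_tree \<Rightarrow> nat" where
  "num_nodes (BBLeaf s) = 1"
| "num_nodes (BBNode j l r) = 1 + num_nodes l + num_nodes r"

text \<open>
  \<open>bb_run n a b p t\<close>: the algorithm may have built \<open>t\<close> below the node \<open>p\<close>.  Whether a 0/1
  solution is found at a node containing one depends on which point of the LP relaxation is
  computed, so at such a node both stopping and branching are permitted (branching only as long
  as an unfixed variable is left).
\<close>

inductive bb_run ::
  "nat \<Rightarrow> (nat \<Rightarrow> nat) \<Rightarrow> int \<Rightarrow> (nat \<rightharpoonup> bool) \<Rightarrow> bb_tree \<Rightarrow> bool"
  for n :: nat and a :: "nat \<Rightarrow> nat" and b :: int where
  bb_open: "bb_run n a b p (BBLeaf Open)"
| bb_pruned: "\<not> lp_feasible n a b p \<Longrightarrow> bb_run n a b p (BBLeaf Pruned)"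
| bb_solved: "lp_solution n a b p x \<Longrightarrow> \<forall>j\<in>{1..n}. x j \<in> {0, 1} \<Longrightarrow>
    bb_run n a b p (BBLeaf Solved)"
| bb_branch: "lp_feasible n a b p \<Longrightarrow> j \<in> {1..n} \<Longrightarrow> j \<notin> dom p \<Longrightarrow>
    bb_run n a b (p(j \<mapsto> False)) l \<Longrightarrow> bb_run n a b (p(j \<mapsto> True)) r \<Longrightarrow>
    bb_run n a b p (BBNode j l r)"

definition complete_bb_run :: "nat \<Rightarrow> (nat \<Rightarrow> nat) \<Rightarrow> int \<Rightarrow> bb_tree \<Rightarrow> bool" where
  "complete_bb_run n a b t \<longleftrightarrow>
     bb_run n a b Map.empty t \<and> (leaf_statuses t = {Pruned} \<or> Solved \<in> leaf_statuses t)"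

definition requires_nodes :: "nat \<Rightarrow> (nat \<Rightarrow> nat) \<Rightarrow> int \<Rightarrow> real \<Rightarrow> bool" where
  "requires_nodes n a b N \<longleftrightarrow> (\<forall>t. complete_bb_run n a b t \<longrightarrow> N \<le> real (num_nodes t))"

end

theory Submission
  imports Defs "HOL-Real_Asymp.Real_Asymp"
begin

text \<open>
  The argument follows Chvatal's analysis of hard knapsack problems.  Put \<open>q = min r (1 - r)\<close> and
  \<open>S = a 1 + \<dots> + a n\<close>.  For a fixed \<open>X \<subseteq> {1..n}\<close>, once all coefficients but one are chosen, at
  most \<open>\<lceil>1 / q\<rceil>\<close> values of the last one make \<open>X\<close> a solution; so a 0/1 solution exists with
  probability at most \<open>2 ^ n * \<lceil>1 / q\<rceil> / M\<close>, which tends to 0 because \<open>10 > 2\<^sup>2\<close>.  By Hoeffding's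
  inequality \<open>S > n * M / 4\<close> with high probability.  In that case fixing at most \<open>q * n / 8\<close>
  variables can neither exceed \<open>\<beta>\<close> nor leave less than \<open>\<beta>\<close> available, so no node of depth at most
  \<open>q * n / 8\<close> is pruned, and the tree has size exponential in \<open>n\<close>.
\<close>

section \<open>Insensitivity of runs to coefficients outside \<open>{1..n}\<close>\<close>

lemma lp_solution_cong:
  assumes "\<And>j. j \<in> {1..n} \<Longrightarrow> a j = a' j"
  shows "lp_solution n a b = lp_solution n a' b"
proof (intro ext)
  fix p x
  have "(\<Sum>j=1..n. real (a j) * x j) = (\<Sum>j=1..n. real (a' j) * x j)"
    by (intro sum.cong) (simp_all add: assms)
  thus "lp_solution n a b p x = lp_solution n a' b p x"
    by (simp only: lp_solution_def)
qed

lemma bb_run_cong_imp: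
  assumes "bb_run n a b p t" "lp_solution n a b = lp_solution n a' b"
  shows "bb_run n a' b p t"
  using assms(1)
proof induction
  case (bb_branch p j l r)
  have "lp_feasible n a' b p"
    using bb_branch.hyps(1) assms(2) by (simp add: lp_feasible_def)
  thus ?case
    using bb_branch.hyps(2,3) bb_branch.IH by (rule bb_run.bb_branch)
next
  case (bb_solved p x)
  thus ?case
    using assms(2) bb_run.bb_solved[of n a' b p x] by simp
qed (use assms(2) in \<open>auto intro: bb_run.intros simp: lp_feasible_def\<close>)

text \<open>The coefficients enter a run only through \<open>lp_solution\<close>. This lets the
  event of the theorem be expressed by the finitely many variables \<open>A 1, ..., A n\<close>, on
  which its measurability rests.\<close>

lemma requires_nodes_cong:
  assumes "\<And>j. j \<in> {1..n} \<Longrightarrow> a j = a' j"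
  shows "requires_nodes n a b N \<longleftrightarrow> requires_nodes n a' b N"
proof -
  have "lp_solution n a b = lp_solution n a' b"
    using assms by (rule lp_solution_cong)
  hence "bb_run n a b = bb_run n a' b"
    by (intro ext iffI) (auto intro: bb_run_cong_imp)
  thus ?thesis
    by (simp add: requires_nodes_def complete_bb_run_def)
qed

section \<open>Lower bound on the size of the tree\<close>

text \<open>Variables fixed to 1 contribute at most \<open>k * m\<close>, hence at most
  \<open>b\<close>; variables fixed to 0 remove at most \<open>k * m\<close>, so \<open>b\<close>
  stays within reach. One common fractional value for all free variables then hits \<open>b\<close>
  exactly.\<close>

lemma lp_feasible_few_fixed:
  assumes dom: "dom p \<subseteq> {1..n}" and card: "card (dom p) \<le> k"
    and le: "\<And>j. j \<in> {1..n} \<Longrightarrow> a j \<le> m"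
    and lower: "int (k * m) \<le> b" and upper: "b \<le> int (\<Sum>j=1..n. a j) - int (k * m)"
  shows "lp_feasible n a b p"
proof -
  define I\<^sub>1 I\<^sub>0 F where "I\<^sub>1 = {j. p j = Some True}" and "I\<^sub>0 = {j. p j = Some False}"
    and "F = {1..n} - dom p"
  define s where "s J = (\<Sum>j\<in>J. real (a j))" for J
  define t where "t = (real_of_int b - s I\<^sub>1) / s F"
  define x where "x j = (case p j of None \<Rightarrow> t | Some v \<Rightarrow> of_bool v)" for j
  have dom_eq: "dom p = I\<^sub>1 \<union> I\<^sub>0" and disj: "I\<^sub>1 \<inter> I\<^sub>0 = {}" "(I\<^sub>1 \<union> I\<^sub>0) \<inter> F = {}"
    by (auto simp: I\<^sub>1_def I\<^sub>0_def F_def)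
  have all_eq: "{1..n} = I\<^sub>1 \<union> I\<^sub>0 \<union> F"
    using dom dom_eq by (auto simp: F_def)
  have fin: "finite I\<^sub>1" "finite I\<^sub>0" "finite F"
    using finite_subset[OF dom] dom_eq by (auto simp: F_def)
  have small: "s J \<le> real (k * m)" if "J \<subseteq> dom p" for J
  proof -
    have "(\<Sum>j\<in>J. a j) \<le> card J * m"
      using le[OF subsetD[OF subset_trans[OF that dom]]] by (intro sum_bounded_above[where 'a = nat, simplified]) auto
    also have "\<dots> \<le> k * m"
      using card card_mono[OF finite_subset[OF dom] that] by (intro mult_right_mono) auto
    finally show ?thesis
      unfolding s_def of_nat_sum[symmetric] of_nat_le_iff .
  qed
  have split: "(\<Sum>j=1..n. real (a j) * y j)
      = (\<Sum>j\<in>I\<^sub>1. real (a j) * y j) + (\<Sum>j\<in>I\<^sub>0. real (a j) * y j) + (\<Sum>j\<in>F. real (a j) * y j)" for y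
    unfolding all_eq using fin disj by (simp add: sum.union_disjoint)
  have S: "real (\<Sum>j=1..n. a j) = s I\<^sub>1 + s I\<^sub>0 + s F"
    using split[of "\<lambda>_. 1"] by (simp add: s_def)
  have lo: "s I\<^sub>1 \<le> real_of_int b"
    using small[of I\<^sub>1] lower dom_eq by (smt (verit) Un_upper1 of_int_le_iff of_int_of_nat_eq)
  have "real_of_int b \<le> real_of_int (int (\<Sum>j=1..n. a j) - int (k * m))"
    using upper by (simp only: of_int_le_iff)
  hence hi: "real_of_int b \<le> s I\<^sub>1 + s F"
    using small[of I\<^sub>0] S dom_eq by simp
  have sF: "0 \<le> s F"
    by (simp add: s_def sum_nonneg)
  \<comment> \<open>If \<open>s F = 0\<close>, then \<open>t = 0\<close> by the convention for
    division by zero; \<open>lo\<close> and \<open>hi\<close> then force \<open>b\<close> to equal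
    \<open>s I\<^sub>1\<close>, so the last equation still holds.\<close>
  have t: "0 \<le> t" "t \<le> 1" "t * s F = real_of_int b - s I\<^sub>1"
    using lo hi sF by (auto simp: t_def divide_simps)
  have "(\<Sum>j=1..n. real (a j) * x j) = s I\<^sub>1 + t * s F"
    unfolding split s_def sum_distrib_left
    by (auto simp: x_def I\<^sub>1_def I\<^sub>0_def F_def dom_def intro!: sum.cong arg_cong2[of _ _ _ _ "(+)"])
  hence "lp_solution n a b p x"
    using t by (auto simp: lp_solution_def x_def split: option.splits)
  thus ?thesis
    by (auto simp: lp_feasible_def)
qed

text \<open>A pruned leaf is infeasible and therefore fixes more than \<open>k\<close> variables. So
  the tree below \<open>p\<close> is complete down to depth \<open>Suc k\<close>, and the bound
  counts only the nodes at that depth. The induction ends at \<open>card (dom p) = Suc k\<close>,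
  where the claim is merely that a tree has a node.\<close>

lemma bb_run_all_pruned_num_nodes_ge:
  assumes "bb_run n a b p t" "leaf_statuses t \<subseteq> {Pruned}" "dom p \<subseteq> {1..n}"
    and "card (dom p) \<le> Suc k"
    and feas: "\<And>q. dom q \<subseteq> {1..n} \<Longrightarrow> card (dom q) \<le> k \<Longrightarrow> lp_feasible n a b q"
  shows "2 ^ (Suc k - card (dom p)) \<le> num_nodes t"
  using assms(1-4)
proof induction
  case (bb_pruned p)
  hence "\<not> card (dom p) \<le> k"
    using feas by blast
  thus ?case
    using bb_pruned by simp
next
  case (bb_branch p j l r)
  have fin: "finite (dom p)"
    using bb_branch.prems finite_subset by blast
  show ?case
  proof (cases "card (dom p) = Suc k")
    case False
    hence le: "card (dom p) \<le> k"
      using bb_branch.prems by simp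
    have card_insert: "card (insert j (dom p)) = Suc (card (dom p))"
      using bb_branch.hyps(3) fin by (rule card_insert_disjoint[rotated])
    have "2 ^ (k - card (dom p)) \<le> num_nodes l"
      using bb_branch.IH(1) bb_branch.hyps(2) bb_branch.prems le
      by (simp add: card_insert del: fun_upd_apply)
    moreover have "2 ^ (k - card (dom p)) \<le> num_nodes r"
      using bb_branch.IH(2) bb_branch.hyps(2) bb_branch.prems le
      by (simp add: card_insert del: fun_upd_apply)
    ultimately
    show ?thesis
      using le by (simp add: Suc_diff_le)
  qed simp
qed auto

text \<open>The ones of the 0/1 point found at the leaf form the set. Used in contrapositive form:
  if no subset sums to \<open>b\<close>, a complete run can only end with all leaves pruned.\<close>

lemma bb_run_Solved_imp_solution:
  assumes "bb_run n a b p t" "Solved \<in> leaf_statuses t"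
  shows "\<exists>X\<subseteq>{1..n}. int (\<Sum>j\<in>X. a j) = b"
  using assms
proof induction
  case (bb_solved p x)
  define X where "X = {j\<in>{1..n}. x j = 1}"
  have "real (\<Sum>j\<in>X. a j) = (\<Sum>j=1..n. real (a j) * x j)"
    unfolding of_nat_sum using bb_solved(2)
    by (intro sum.mono_neutral_cong_left) (auto simp: X_def)
  also have "\<dots> = real_of_int b"
    using bb_solved by (simp add: lp_solution_def)
  finally have "int (\<Sum>j\<in>X. a j) = b"
    by linarith
  thus ?case
    by (intro exI[of _ X]) (auto simp: X_def)
qed auto

lemma requires_nodes_power:
  assumes "\<And>j. j \<in> {1..n} \<Longrightarrow> a j \<le> m"
    and "int (k * m) \<le> b" and "b \<le> int (\<Sum>j=1..n. a j) - int (k * m)"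
    and "\<And>X. X \<subseteq> {1..n} \<Longrightarrow> int (\<Sum>j\<in>X. a j) \<noteq> b"
  shows "requires_nodes n a b (2 ^ Suc k)"
  unfolding requires_nodes_def complete_bb_run_def
proof (intro allI impI)
  fix t assume t: "bb_run n a b Map.empty t \<and> (leaf_statuses t = {Pruned} \<or> Solved \<in> leaf_statuses t)"
  have "Solved \<notin> leaf_statuses t"
    using bb_run_Solved_imp_solution[of n a b] t assms(4) by blast
  hence "2 ^ (Suc k - card (dom (Map.empty :: nat \<rightharpoonup> bool))) \<le> num_nodes t"
    using t lp_feasible_few_fixed[of _ n k a m b, OF _ _ assms(1-3)]
    by (intro bb_run_all_pruned_num_nodes_ge[where n = n and a = a and b = b]) auto
  hence "2 ^ Suc k \<le> num_nodes t"
    by simp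
  hence "real (2 ^ Suc k) \<le> real (num_nodes t)"
    by (simp only: of_nat_le_iff)
  thus "2 ^ Suc k \<le> real (num_nodes t)"
    by simp
qed

section \<open>Counting the coefficient vectors for which a given subset is a solution\<close>

text \<open>A nonempty \<open>T\<close> lies in the window of length \<open>K\<close> that starts at
  its least element.\<close>

lemma card_le_of_diff_less:
  fixes T :: "nat set"
  assumes "\<And>u v. u \<in> T \<Longrightarrow> v \<in> T \<Longrightarrow> v < u + K"
  shows "card T \<le> K"
proof (cases "T = {}")
  case False
  define u where "u = (LEAST u. u \<in> T)"
  have u: "u \<in> T" "\<And>v. v \<in> T \<Longrightarrow> u \<le> v"
    using False by (auto simp: u_def intro: LeastI Least_le)
  hence "T \<subseteq> {u..<u + K}"
    using assms by auto
  thus ?thesis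
    using card_mono[of "{u..<u + K}" T] by simp
qed simp

lemma card_subset_sum_floor_le:
  fixes r :: real
  assumes r: "0 < r" "r < 1" and I: "finite I" "i \<notin> I" and X: "X \<subseteq> insert i I"
  shows "card {f \<in> insert i I \<rightarrow>\<^sub>E {1..m}. int (\<Sum>j\<in>X. f j) = \<lfloor>r * real (\<Sum>j\<in>insert i I. f j)\<rfloor>}
    \<le> nat \<lceil>1 / min r (1 - r)\<rceil> * m ^ card I"
    (is "card {f \<in> _. ?Q f} \<le> ?K * _")
proof -
  define T where "T g = {y \<in> {1..m}. ?Q (g(i := y))}" for g :: "_ \<Rightarrow> nat"
  define q where "q = min r (1 - r)"
  have q: "0 < q"
    using r by (simp add: q_def)
  have T: "card (T g) \<le> ?K" for g
  proof (rule card_le_of_diff_less)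
    fix u v assume uv: "u \<in> T g" "v \<in> T g"
    \<comment> \<open>The slope is \<open>1 - r\<close> or \<open>- r\<close> according to whether
      \<open>i \<in> X\<close>; \<open>c\<close> collects the terms free of the varying
      coefficient.\<close>
    define d where "d = of_bool (i \<in> X) - r"
    define c where "c = real (\<Sum>j\<in>X - {i}. g j) - r * real (\<Sum>j\<in>I. g j)"
    have "finite X"
      using X I finite_subset by blast
    have X_sum: "(\<Sum>j\<in>X. (g(i := y)) j) = (\<Sum>j\<in>X - {i}. g j) + of_bool (i \<in> X) * y" for y
    proof (cases "i \<in> X")
      case True
      then show ?thesis
        using \<open>finite X\<close> by (simp add: sum.remove)
    next
      case False
      then show ?thesis by (auto intro!: sum.cong)
    qed
    have I_sum: "(\<Sum>j\<in>insert i I. (g(i := y)) j) = (\<Sum>j\<in>I. g j) + y" for y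
    proof -
      have "(\<Sum>j\<in>I. (g(i := y)) j) = (\<Sum>j\<in>I. g j)"
        using I by (intro sum.cong) auto
      thus ?thesis using I by simp
    qed
    have in_T: "- 1 < c + d * real y \<and> c + d * real y \<le> 0" if "y \<in> T g" for y
    proof -
      have "int ((\<Sum>j\<in>X - {i}. g j) + of_bool (i \<in> X) * y) = \<lfloor>r * real ((\<Sum>j\<in>I. g j) + y)\<rfloor>"
        using that unfolding T_def X_sum I_sum by simp
      from this[symmetric] show ?thesis
        unfolding floor_eq_iff by (simp add: c_def d_def algebra_simps split: if_splits)
    qed
    show "v < u + ?K"
    proof (cases "u < v")
      case True
      have "q * real (v - u) \<le> \<bar>d\<bar> * real (v - u)"
        using r by (intro mult_right_mono) (auto simp: q_def d_def)
      also have "\<dots> = \<bar>(c + d * real v) - (c + d * real u)\<bar>"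
        using True by (subst add_diff_add) (simp add: abs_mult of_nat_diff flip: right_diff_distrib)
      also have "\<dots> < 1"
        using in_T[OF uv(1)] in_T[OF uv(2)] by linarith
      finally have "real (v - u) < 1 / q"
        using q by (simp add: field_simps)
      also have "\<dots> \<le> real (nat \<lceil>1 / q\<rceil>)"
        by linarith
      finally show ?thesis
        by (simp add: q_def)
    next
      case False
      have "0 < 1 / q" using q by simp
      hence "0 < ?K" unfolding q_def by linarith
      with False show ?thesis by linarith
    qed
  qed
  have fin: "finite (T g)" for g by (simp add: T_def)
  have finI: "finite (I \<rightarrow>\<^sub>E {1..m})" using I by (intro finite_PiE) auto
  \<comment> \<open>Each counted vector splits into its restriction \<open>g\<close> to
    \<open>I\<close> and its value at \<open>i\<close>, which lies in \<open>T g\<close>.\<close>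
  have "{f \<in> insert i I \<rightarrow>\<^sub>E {1..m}. ?Q f} \<subseteq> (\<lambda>(g, y). g(i := y)) ` (SIGMA g:I \<rightarrow>\<^sub>E {1..m}. T g)"
    by (auto simp: PiE_insert_eq T_def image_iff)
  hence "card {f \<in> insert i I \<rightarrow>\<^sub>E {1..m}. ?Q f} \<le> card (SIGMA g:I \<rightarrow>\<^sub>E {1..m}. T g)"
    using fin finI by (intro surj_card_le) auto
  also have "\<dots> = (\<Sum>g\<in>I \<rightarrow>\<^sub>E {1..m}. card (T g))"
    using fin finI by simp
  also have "\<dots> \<le> card (I \<rightarrow>\<^sub>E {1..m}) * ?K"
    using sum_bounded_above[of "I \<rightarrow>\<^sub>E {1..m}" "\<lambda>g. card (T g)" ?K] T by simp
  also have "\<dots> = ?K * m ^ card I"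
    using I by (simp add: card_PiE)
  finally show ?thesis .
qed

section \<open>Measurability and tail estimates for independent uniform variables\<close>

context prob_space begin

text \<open>An arbitrary predicate of finitely many countably valued variables gives an event: it is
  a countable union, over the admissible value vectors, of finite intersections of point
  preimages.\<close>

lemma measurable_discrete_vector:
  fixes A :: "'b \<Rightarrow> 'a \<Rightarrow> 'c :: countable"
  assumes "finite I" and A: "\<And>j. j \<in> I \<Longrightarrow> random_variable (count_space UNIV) (A j)"
    and cong: "\<And>f g. (\<And>j. j \<in> I \<Longrightarrow> f j = g j) \<Longrightarrow> Q f \<longleftrightarrow> Q g"
  shows "{\<omega> \<in> space M. Q (\<lambda>j. A j \<omega>)} \<in> events"
proof -
  \<comment> \<open>Extensional functions give one representative per value vector, which keeps
    \<open>F\<close> countable.\<close>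
  define F where "F = {f \<in> I \<rightarrow>\<^sub>E UNIV. Q f}"
  have "Q (\<lambda>j. A j \<omega>) \<longleftrightarrow> (\<exists>f\<in>F. \<forall>j\<in>I. A j \<omega> = f j)" for \<omega>
  proof
    assume "Q (\<lambda>j. A j \<omega>)"
    also have "?this \<longleftrightarrow> Q (restrict (\<lambda>j. A j \<omega>) I)"
      by (rule cong) simp
    finally show "\<exists>f\<in>F. \<forall>j\<in>I. A j \<omega> = f j"
      by (intro bexI[of _ "restrict (\<lambda>j. A j \<omega>) I"]) (auto simp: F_def)
  next
    assume "\<exists>f\<in>F. \<forall>j\<in>I. A j \<omega> = f j"
    then obtain f where "Q f" "\<And>j. j \<in> I \<Longrightarrow> A j \<omega> = f j"
      by (auto simp: F_def)
    thus "Q (\<lambda>j. A j \<omega>)"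
      using cong[of "\<lambda>j. A j \<omega>" f] by simp
  qed
  hence "{\<omega> \<in> space M. Q (\<lambda>j. A j \<omega>)} = (\<Union>f\<in>F. {\<omega> \<in> space M. \<forall>j\<in>I. A j \<omega> = f j})"
    by auto
  also have "\<dots> \<in> events"
  proof (rule sets.countable_UN'')
    show "countable F"
      unfolding F_def using \<open>finite I\<close>
      by (intro countable_subset[OF _ countable_PiE[of I "\<lambda>_. UNIV"]]) auto
    have "{\<omega> \<in> space M. A j \<omega> = f j} \<in> events" if "j \<in> I" for f j
      using measurable_sets[OF A[OF that], of "{f j}"] by (simp add: vimage_def Int_def conj_commute)
    thus "{\<omega> \<in> space M. \<forall>j\<in>I. A j \<omega> = f j} \<in> events" for f
      using \<open>finite I\<close> by (intro sets.sets_Collect_finite_All) auto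
  qed
  finally show ?thesis .
qed

lemma prob_uniform_eq:
  assumes "random_variable (count_space UNIV) X"
    and "distr M (count_space UNIV) X = measure_pmf (pmf_of_set S)" and "finite S" "S \<noteq> {}"
  shows "prob (X -` T \<inter> space M) = real (card (S \<inter> T)) / real (card S)"
proof -
  have "prob (X -` T \<inter> space M) = measure (distr M (count_space UNIV) X) T"
    using assms(1) by (simp add: measure_distr)
  also have "\<dots> = real (card (S \<inter> T)) / real (card S)"
    using assms by (simp add: measure_pmf_of_set)
  finally show ?thesis .
qed

lemma AE_uniform_mem:
  assumes "random_variable (count_space UNIV) X"
    and "distr M (count_space UNIV) X = measure_pmf (pmf_of_set S)" and "finite S" "S \<noteq> {}"
  shows "AE \<omega> in M. X \<omega> \<in> S"
proof -
  have "AE x in distr M (count_space UNIV) X. x \<in> S"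
    unfolding assms(2) using assms(3,4) by (simp add: AE_measure_pmf_iff)
  thus ?thesis
    using assms(1) by (simp add: AE_distr_iff)
qed

text \<open>Turns counting into probability: by independence each single vector has probability
  \<open>1 / card S ^ card I\<close>, and a union bound over \<open>B\<close> finishes.\<close>

lemma prob_uniform_vector_mem_le:
  assumes indep: "indep_vars (\<lambda>_. count_space UNIV) A I" and I: "finite I" "I \<noteq> {}"
    and distr: "\<And>j. j \<in> I \<Longrightarrow> distr M (count_space UNIV) (A j) = measure_pmf (pmf_of_set S)"
    and S: "finite S" "S \<noteq> {}" and B: "B \<subseteq> I \<rightarrow>\<^sub>E S"
  shows "prob {\<omega> \<in> space M. \<exists>f\<in>B. \<forall>j\<in>I. A j \<omega> = f j} \<le> real (card B) / real (card S) ^ card I"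
proof -
  have rv: "random_variable (count_space UNIV) (A j)" if "j \<in> I" for j
    using indep that by (auto simp: indep_vars_def)
  define E where "E f = (\<Inter>j\<in>I. A j -` {f j} \<inter> space M)" for f
  have "finite B"
    using B I S finite_PiE finite_subset by metis
  have E: "E f \<in> events" for f
    unfolding E_def using I rv by (intro sets.finite_INT) (auto intro: measurable_sets)
  have prob_E: "prob (E f) = 1 / real (card S) ^ card I" if "f \<in> B" for f
  proof -
    have "prob (E f) = (\<Prod>j\<in>I. prob (A j -` {f j} \<inter> space M))"
      unfolding E_def using I by (intro indep_varsD_finite[OF indep]) auto
    also have "\<dots> = (\<Prod>j\<in>I. 1 / real (card S))"
    proof (intro prod.cong refl)
      fix j assume "j \<in> I"
      moreover from this have "S \<inter> {f j} = {f j}"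
        using B that by auto
      ultimately show "prob (A j -` {f j} \<inter> space M) = 1 / real (card S)"
        using prob_uniform_eq[OF rv distr S, of j "{f j}"] by simp
    qed
    finally show ?thesis
      by (simp add: power_divide)
  qed
  have "{\<omega> \<in> space M. \<exists>f\<in>B. \<forall>j\<in>I. A j \<omega> = f j} = (\<Union>f\<in>B. E f)"
    using I by (auto simp: E_def)
  hence "prob {\<omega> \<in> space M. \<exists>f\<in>B. \<forall>j\<in>I. A j \<omega> = f j} \<le> (\<Sum>f\<in>B. prob (E f))"
    using \<open>finite B\<close> E by (simp add: finite_measure_subadditive_finite image_subset_iff)
  also have "\<dots> = real (card B) / real (card S) ^ card I"
    by (simp add: prob_E)
  finally show ?thesis .
qed

lemma expectation_uniform_atLeastAtMost:
  assumes "random_variable (count_space UNIV) X" and "1 \<le> m"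
    and "distr M (count_space UNIV) X = measure_pmf (pmf_of_set {1..m})"
  shows "expectation (\<lambda>\<omega>. real (X \<omega>)) = (real m + 1) / 2"
proof -
  have "expectation (\<lambda>\<omega>. real (X \<omega>)) = integral\<^sup>L (distr M (count_space UNIV) X) real"
    using assms(1) by (simp add: integral_distr)
  also have "\<dots> = (\<Sum>x=1..m. real x) / real m"
    unfolding assms(3) using \<open>1 \<le> m\<close> by (simp add: integral_pmf_of_set)
  also have "(\<Sum>x=1..m. real x) = real m * (real m + 1) / 2"
    by (induction m) (simp_all add: field_simps)
  finally show ?thesis
    using \<open>1 \<le> m\<close> by simp
qed

lemma prob_sum_uniform_le:
  assumes indep: "indep_vars (\<lambda>_. count_space UNIV) A I" and I: "finite I" "I \<noteq> {}" and m: "1 \<le> m"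
    and distr: "\<And>j. j \<in> I \<Longrightarrow> distr M (count_space UNIV) (A j) = measure_pmf (pmf_of_set {1..m})"
  shows "prob {\<omega> \<in> space M. (\<Sum>j\<in>I. real (A j \<omega>)) \<le> real (card I) * real m / 4} \<le> exp (- real (card I) / 8)"
proof -
  have rv: "random_variable (count_space UNIV) (A j)" if "j \<in> I" for j
    using indep that by (auto simp: indep_vars_def)
  define n where "n = real (card I)"
  have n: "0 < n"
    using I by (simp add: n_def card_gt_0_iff)
  \<comment> \<open>The range \<open>{0..m}\<close> has width exactly \<open>m\<close>, so
    \<open>m\<close> cancels from the Hoeffding exponent.\<close>
  interpret Hoeffding_ineq M I "\<lambda>j \<omega>. real (A j \<omega>)" "\<lambda>_. 0" "\<lambda>_. real m" "n * (real m + 1) / 2"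
  proof unfold_locales
    show "indep_vars (\<lambda>_. borel) (\<lambda>j \<omega>. real (A j \<omega>)) I"
      by (rule indep_vars_compose2[OF indep]) simp
    show "AE \<omega> in M. real (A j \<omega>) \<in> {0..real m}" if "j \<in> I" for j
      using AE_uniform_mem[OF rv distr, of j] that m by auto
    show "n * (real m + 1) / 2 \<equiv> \<Sum>j\<in>I. expectation (\<lambda>\<omega>. real (A j \<omega>))"
      by (intro eq_reflection) (simp add: expectation_uniform_atLeastAtMost[OF rv m distr] n_def)
  qed fact
  \<comment> \<open>The mean exceeds \<open>n * m / 2\<close>, so the threshold
    \<open>n * m / 4\<close> lies at least \<open>n * m / 4\<close> below it; this deviation gives
    the exponent \<open>- n / 8\<close>.\<close>
  have "prob {\<omega> \<in> space M. (\<Sum>j\<in>I. real (A j \<omega>)) \<le> n * m / 4}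
      \<le> prob {\<omega> \<in> space M. (\<Sum>j\<in>I. real (A j \<omega>)) \<le> n * (real m + 1) / 2 - n * m / 4}"
    using n by (intro finite_measure_mono) (auto simp: field_simps)
  also have "\<dots> \<le> exp (- 2 * (n * m / 4)\<^sup>2 / (\<Sum>j\<in>I. (real m - 0)\<^sup>2))"
    using n m by (intro Hoeffding_ineq_le) (auto simp: n_def)
  also have "- 2 * (n * m / 4)\<^sup>2 / (\<Sum>j\<in>I. (real m - 0)\<^sup>2) = - n / 8"
    using n m by (simp add: field_simps power2_eq_square flip: n_def)
  finally show ?thesis
    by (simp add: n_def)
qed

end

section \<open>Failure probability for a fixed \<open>n\<close>\<close>

lemma requires_nodes_antimono:
  "requires_nodes n a b N \<Longrightarrow> N' \<le> N \<Longrightarrow> requires_nodes n a b N'"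
  unfolding requires_nodes_def by (meson order_trans)

text \<open>The two subtracted terms bound the two bad events: a small total weight (Hoeffding) and
  the existence of a 0/1 solution (counting). Off both, \<open>requires_nodes_power\<close> applies
  almost surely.\<close>

lemma (in prob_space) prob_requires_nodes_ge:
  fixes r :: real
  defines "q \<equiv> min r (1 - r)"
  assumes r: "0 < r" "r < 1" and n: "1 \<le> n" and m: "1 \<le> m"
    and indep: "indep_vars (\<lambda>_. count_space UNIV) A {1..n}"
    and distr: "\<And>j. j \<in> {1..n} \<Longrightarrow> distr M (count_space UNIV) (A j) = measure_pmf (pmf_of_set {1..m})"
    and k: "real k \<le> q * real n / 8" and nm: "8 \<le> q * real n * real m"
    and N: "N \<le> 2 ^ Suc k"
  shows "1 - exp (- real n / 8) - 2 ^ n * real (nat \<lceil>1 / q\<rceil>) / real m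
    \<le> prob {\<omega> \<in> space M. requires_nodes n (\<lambda>j. A j \<omega>) \<lfloor>r * real (\<Sum>j=1..n. A j \<omega>)\<rfloor> N}"
    (is "_ \<le> prob ?G")
proof -
  have rv: "random_variable (count_space UNIV) (A j)" if "j \<in> {1..n}" for j
    using indep that by (auto simp: indep_vars_def)
  define B\<^sub>X where "B\<^sub>X X = {f \<in> {1..n} \<rightarrow>\<^sub>E {1..m}. int (\<Sum>j\<in>X. f j) = \<lfloor>r * real (\<Sum>j=1..n. f j)\<rfloor>}" for X
  define B where "B = (\<Union>X\<in>Pow {1..n}. B\<^sub>X X)"
  define E\<^sub>1 where "E\<^sub>1 = {\<omega> \<in> space M. (\<Sum>j=1..n. real (A j \<omega>)) \<le> real n * real m / 4}"
  \<comment> \<open>Elements of \<open>B\<close> are extensional while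
    \<open>\<lambda>j. A j \<omega>\<close> need not be, hence agreement on \<open>{1..n}\<close>
    instead of membership.\<close>
  define E\<^sub>2 where "E\<^sub>2 = {\<omega> \<in> space M. \<exists>f\<in>B. \<forall>j\<in>{1..n}. A j \<omega> = f j}"
  have G: "?G \<in> events"
  proof (rule measurable_discrete_vector[where I = "{1..n}"
        and Q = "\<lambda>f. requires_nodes n f \<lfloor>r * real (\<Sum>j=1..n. f j)\<rfloor> N"])
    fix f g :: "nat \<Rightarrow> nat"
    assume eq: "\<And>j. j \<in> {1..n} \<Longrightarrow> f j = g j"
    hence "(\<Sum>j=1..n. f j) = (\<Sum>j=1..n. g j)"
      by (rule sum.cong[OF refl])
    thus "requires_nodes n f \<lfloor>r * real (\<Sum>j=1..n. f j)\<rfloor> N \<longleftrightarrow> requires_nodes n g \<lfloor>r * real (\<Sum>j=1..n. g j)\<rfloor> N"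
      using requires_nodes_cong[OF eq] by simp
  qed (simp_all add: rv)
  have E\<^sub>1: "E\<^sub>1 \<in> events"
    unfolding E\<^sub>1_def
    by (rule measurable_discrete_vector[where I = "{1..n}" and Q = "\<lambda>f. (\<Sum>j=1..n. real (f j)) \<le> real n * real m / 4"])
      (simp_all add: rv cong: sum.cong_simp)
  have E\<^sub>2: "E\<^sub>2 \<in> events"
    unfolding E\<^sub>2_def
    by (rule measurable_discrete_vector[where I = "{1..n}" and Q = "\<lambda>g. \<exists>f\<in>B. \<forall>j\<in>{1..n}. g j = f j"])
      (simp_all add: rv)

  have card_B: "card B \<le> 2 ^ n * (nat \<lceil>1 / q\<rceil> * m ^ (n - 1))"
  proof -
    have "card B \<le> (\<Sum>X\<in>Pow {1..n}. card (B\<^sub>X X))"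
      unfolding B_def by (rule card_UN_le) simp
    also have "\<dots> \<le> card (Pow {1..n}) * (nat \<lceil>1 / q\<rceil> * m ^ (n - 1))"
    proof (rule sum_bounded_above[where 'a = nat, simplified])
      fix X assume X: "X \<in> Pow {1..n}"
      \<comment> \<open>The last coefficient is the one left varying. The remaining
        \<open>n - 1\<close> give \<open>m ^ (n - 1)\<close>, so one factor \<open>m\<close>
        survives in the denominator of the bound on \<open>prob E\<^sub>2\<close>.\<close>
      have "{1..n} = insert n {1..<n}"
        using n by auto
      thus "card (B\<^sub>X X) \<le> nat \<lceil>1 / q\<rceil> * m ^ (n - 1)"
        using card_subset_sum_floor_le[of r "{1..<n}" n X m] r X by (simp add: B\<^sub>X_def q_def)
    qed
    finally show ?thesis by (simp add: card_Pow)
  qed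
  have "prob E\<^sub>2 \<le> real (card B) / real (card {1..m}) ^ card {1..n}"
    unfolding E\<^sub>2_def using n m
    by (intro prob_uniform_vector_mem_le[OF indep _ _ distr]) (auto simp: B_def B\<^sub>X_def)
  also have "\<dots> \<le> real (2 ^ n * (nat \<lceil>1 / q\<rceil> * m ^ (n - 1))) / real m ^ n"
    using card_B by (simp del: of_nat_mult of_nat_power add: divide_right_mono)
  also have "\<dots> = 2 ^ n * real (nat \<lceil>1 / q\<rceil>) / real m"
    using n m by (cases n) (simp_all add: field_simps)
  finally have prob_E\<^sub>2: "prob E\<^sub>2 \<le> 2 ^ n * real (nat \<lceil>1 / q\<rceil>) / real m" .
  have prob_E\<^sub>1: "prob E\<^sub>1 \<le> exp (- real n / 8)"
    unfolding E\<^sub>1_def using prob_sum_uniform_le[OF indep _ _ m distr] n by simp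

  \<comment> \<open>Only the distributions are given, so the coefficients lie in
    \<open>{1..m}\<close> only almost surely; the final comparison of events is therefore up to a
    null set.\<close>
  have "AE \<omega> in M. \<forall>j\<in>{1..n}. A j \<omega> \<in> {1..m}"
    using AE_uniform_mem[OF rv distr] m by (intro AE_finite_allI) auto
  hence "AE \<omega> in M. \<omega> \<in> space M \<longrightarrow> \<omega> \<in> ?G \<union> (E\<^sub>1 \<union> E\<^sub>2)"
  proof eventually_elim
    case (elim \<omega>)
    define a where "a = (\<lambda>j. A j \<omega>)"
    define S where "S = (\<Sum>j=1..n. a j)"
    have "\<omega> \<in> ?G" if \<omega>: "\<omega> \<in> space M" "\<omega> \<notin> E\<^sub>1" "\<omega> \<notin> E\<^sub>2"
    proof -
      have S: "real n * real m / 4 < real S"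
        using \<omega> by (simp add: E\<^sub>1_def S_def a_def)
      have q: "0 < q" "q \<le> r" "q \<le> 1 - r"
        using r by (auto simp: q_def)
      have km: "real k * real m \<le> q * real n * real m / 8"
        using mult_right_mono[OF k, of "real m"] by simp
      \<comment> \<open>\<open>q \<le> r\<close> serves the variables fixed to 1, and
        \<open>q \<le> 1 - r\<close> those fixed to 0. Both quantities are at least twice the bound
        on \<open>k * m\<close> in \<open>km\<close>.\<close>
      have "q * (real n * real m / 4) \<le> r * real S" "q * (real n * real m / 4) \<le> (1 - r) * real S"
        using q S r mult_mono[of q r "real n * real m / 4" "real S"]
          mult_mono[of q "1 - r" "real n * real m / 4" "real S"] by simp_all
      hence S_r: "q * real n * real m / 4 \<le> r * real S" "q * real n * real m / 4 \<le> real S - r * real S"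
        by (simp_all add: algebra_simps)
      have "real k * real m \<le> r * real S - 1"
        using km S_r nm by linarith
      hence lower: "int (k * m) \<le> \<lfloor>r * real S\<rfloor>"
        by (simp add: le_floor_iff)
      have "real_of_int \<lfloor>r * real S\<rfloor> \<le> real_of_int (int S - int (k * m))"
        using km S_r nm of_int_floor_le[of "r * real S"]
        unfolding of_int_diff of_int_of_nat_eq of_nat_mult[where 'a = real] by linarith
      hence upper: "\<lfloor>r * real S\<rfloor> \<le> int S - int (k * m)"
        by (simp only: of_int_le_iff)
      have "int (\<Sum>j\<in>X. a j) \<noteq> \<lfloor>r * real S\<rfloor>" if X: "X \<subseteq> {1..n}" for X
      proof
        assume eq: "int (\<Sum>j\<in>X. a j) = \<lfloor>r * real S\<rfloor>"
        have "(\<Sum>j\<in>X. restrict a {1..n} j) = (\<Sum>j\<in>X. a j)"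
          using X by (intro sum.cong) auto
        moreover have "(\<Sum>j=1..n. restrict a {1..n} j) = S"
          unfolding S_def by (intro sum.cong) auto
        moreover have "restrict a {1..n} \<in> {1..n} \<rightarrow>\<^sub>E {1..m}"
          using elim by (auto simp: a_def)
        ultimately have "restrict a {1..n} \<in> B\<^sub>X X"
          unfolding B\<^sub>X_def using eq by (simp only: mem_Collect_eq)
        hence "restrict a {1..n} \<in> B"
          using X by (auto simp: B_def)
        hence "\<omega> \<in> E\<^sub>2"
          using \<omega>(1) by (auto simp: E\<^sub>2_def a_def intro!: bexI[of _ "restrict a {1..n}"])
        thus False using \<omega> by simp
      qed
      moreover have "a j \<le> m" if "j \<in> {1..n}" for j
        using elim that by (auto simp: a_def)
      ultimately have "requires_nodes n a \<lfloor>r * real S\<rfloor> (2 ^ Suc k)"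
        using lower upper by (intro requires_nodes_power) (auto simp: S_def)
      hence "requires_nodes n a \<lfloor>r * real S\<rfloor> N"
        using N by (rule requires_nodes_antimono)
      thus ?thesis
        using \<omega> by (simp add: a_def S_def)
    qed
    thus ?case by blast
  qed
  hence "prob (space M) \<le> prob (?G \<union> (E\<^sub>1 \<union> E\<^sub>2))"
    using G E\<^sub>1 E\<^sub>2 by (intro finite_measure_mono_AE) auto
  also have "\<dots> \<le> prob ?G + (prob E\<^sub>1 + prob E\<^sub>2)"
    using measure_Un_le[OF G sets.Un[OF E\<^sub>1 E\<^sub>2]] measure_Un_le[OF E\<^sub>1 E\<^sub>2] by linarith
  finally show ?thesis
    using prob_E\<^sub>1 prob_E\<^sub>2 prob_space by linarith
qed

section \<open>Passage to the limit\<close>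

theorem theorem1:
  fixes r \<epsilon> :: real
    and P :: "nat \<Rightarrow> 'w measure"
    and A :: "nat \<Rightarrow> nat \<Rightarrow> 'w \<Rightarrow> nat"
  assumes "0 < r" and "r < 1" and "0 < \<epsilon>" and "\<epsilon> < 1"
    and "\<And>n. 1 \<le> n \<Longrightarrow> prob_space (P n)"
    and "\<And>n. 1 \<le> n \<Longrightarrow> prob_space.indep_vars (P n) (\<lambda>_. count_space UNIV) (A n) {1..n}"
    and "\<And>n j. 1 \<le> n \<Longrightarrow> j \<in> {1..n} \<Longrightarrow>
           distr (P n) (count_space UNIV) (A n j) =
           measure_pmf (pmf_of_set {1..nat \<lfloor>10 powr (real n / 2)\<rfloor>})"
  shows "(\<lambda>n. measure (P n) {\<omega> \<in> space (P n).
             requires_nodes n (\<lambda>j. A n j \<omega>) \<lfloor>r * real (\<Sum>j=1..n. A n j \<omega>)\<rfloor>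
               (2 powr (real n powr (1 - \<epsilon>)))}) \<longlonglongrightarrow> 1"
    (is "?p \<longlonglongrightarrow> 1")
proof (rule tendsto_sandwich)
  define q where "q = min r (1 - r)"
  define K where "K = real (nat \<lceil>1 / q\<rceil>)"
  define m where "m n = nat \<lfloor>10 powr (real n / 2)\<rfloor>" for n
  have q: "0 < q"
    using assms(1,2) by (simp add: q_def)
  \<comment> \<open>\<open>10 powr (n / 2)\<close> is the \<open>n\<close>-th power of
    \<open>sqrt 10\<close>, which is at least 3; the \<open>- 1\<close> pays for the floor. Base 3
    still beats the \<open>2 ^ n\<close> subsets, so the failure bound vanishes.\<close>
  have m: "3 ^ n - 1 \<le> real (m n)" "1 \<le> m n" for n
  proof -
    have "3 \<le> sqrt 10"
      by (rule real_le_rsqrt) simp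
    hence "3 ^ n \<le> sqrt 10 ^ n"
      by (intro power_mono) auto
    also have "\<dots> = 10 powr (real n / 2)"
      by (simp add: powr_half_sqrt[symmetric] powr_powr flip: powr_realpow)
    finally have "3 ^ n \<le> 10 powr (real n / 2)" .
    moreover have "1 \<le> 10 powr (real n / 2)"
      by (simp add: ge_one_powr_ge_zero)
    ultimately show "3 ^ n - 1 \<le> real (m n)" "1 \<le> m n"
      unfolding m_def by linarith+
  qed
  show "\<forall>\<^sub>F n in sequentially. ?p n \<le> 1"
    using eventually_ge_at_top[of 1]
    by eventually_elim (intro prob_space.prob_le_1 assms(5))
  show "(\<lambda>n. 1 - exp (- real n / 8) - 2 ^ n * K / (3 ^ n - 1)) \<longlonglongrightarrow> 1"
    by real_asymp
  \<comment> \<open>This is where \<open>\<epsilon> > 0\<close> enters: the required exponent is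
    sublinear, while the available one grows like \<open>q * n / 8\<close>.\<close>
  have "(\<lambda>n. real n powr (1 - \<epsilon>) / real n) \<longlonglongrightarrow> 0"
    using assms(3) by real_asymp
  hence "\<forall>\<^sub>F n in sequentially. real n powr (1 - \<epsilon>) / real n < q / 8"
    using q by (intro order_tendstoD(2)) auto
  moreover have "\<forall>\<^sub>F n in sequentially. 8 / q \<le> real n"
    by (rule eventually_ge_at_top[THEN eventually_compose_filterlim, OF filterlim_real_sequentially])
  ultimately show "\<forall>\<^sub>F n in sequentially.
      1 - exp (- real n / 8) - 2 ^ n * K / (3 ^ n - 1) \<le> ?p n"
    using eventually_ge_at_top[of 1]
  proof eventually_elim
    case (elim n)
    \<comment> \<open>The largest depth within the feasibility bound. Rounding down loses less than
      1, which the exponent \<open>Suc k\<close> in the tree bound makes up for.\<close>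
    define k where "k = nat \<lfloor>q * real n / 8\<rfloor>"
    have k: "real k \<le> q * real n / 8" "q * real n / 8 \<le> real (Suc k)"
    proof -
      have "0 \<le> q * real n / 8"
        using q by simp
      thus "real k \<le> q * real n / 8" "q * real n / 8 \<le> real (Suc k)"
        unfolding k_def by linarith+
    qed
    have "real n powr (1 - \<epsilon>) \<le> real (Suc k)"
      using elim k by (simp add: field_simps)
    hence "2 powr (real n powr (1 - \<epsilon>)) \<le> 2 powr real (Suc k)"
      by (intro powr_mono) auto
    also have "\<dots> = 2 ^ Suc k"
      by (rule powr_realpow) simp
    finally have N: "2 powr (real n powr (1 - \<epsilon>)) \<le> 2 ^ Suc k" .
    have "8 \<le> q * real n"
      using elim q by (simp add: field_simps)
    also have "\<dots> \<le> q * real n * real (m n)"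
      using mult_left_mono[of 1 "real (m n)" "q * real n"] m(2)[of n] q by simp
    finally have nm: "8 \<le> q * real n * real (m n)" .
    \<comment> \<open>Makes the denominator \<open>3 ^ n - 1\<close> positive, so that it can
      replace the larger \<open>m n\<close>.\<close>
    have "1 < (3 :: real) ^ n"
      using elim by (intro one_less_power) auto
    hence "2 ^ n * K / real (m n) \<le> 2 ^ n * K / (3 ^ n - 1)"
      using m(1)[of n] by (intro divide_left_mono mult_pos_pos) (auto simp: K_def)
    hence "1 - exp (- real n / 8) - 2 ^ n * K / (3 ^ n - 1)
        \<le> 1 - exp (- real n / 8) - 2 ^ n * K / real (m n)"
      by simp
    also have "\<dots> \<le> ?p n"
      unfolding K_def q_def using assms(1,2) elim m(2) assms(6,7) k(1) nm N
      by (intro prob_space.prob_requires_nodes_ge[OF assms(5), where k = k]) (auto simp: q_def m_def)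
    finally show ?case .
  qed
qed simp

end
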